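(* Let $\mathcal X=\mathbb R^n$ or let $\mathcal X\subseteq\mathbb R^n$ be closed, bounded and convex, and let $f_1,\dots,f_k:\mathbb R^n\to\mathbb R$ be continuously differentiable on $\mathcal X$ with gradients $\nabla f_\ell$, $\ell=1,\dots,k$, that are Lipschitz continuous on $\mathcal X$. Then the map $\omega:\mathcal X\to\mathbb R$, $$\omega(x):=-\min_{\substack{d\in\mathcal X-x\\ \|d\|\le1}}\ \max_{\ell=1,\dots,k}\langle\nabla f_\ell(x),d\rangle,$$ is uniformly continuous.
   Context: $\|\cdot\|=\|\cdot\|_\infty$ is the maximum norm, $\mathcal X\neq\emptyset$, $\langle\cdot,\cdot\rangle$ the standard inner product on $\mathbb R^n$, $\mathcal X-x=\{y-x:y\in\mathcal X\}$ (equal to $\mathbb R^n$ if $\mathcal X=\mathbb R^n$). *)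

theory Defs
  imports "HOL-Analysis.Analysis"
begin

definition gradient :: "(real ^ 'n \<Rightarrow> real) \<Rightarrow> real ^ 'n \<Rightarrow> real ^ 'n"
  where "gradient f x = (THE D. GDERIV f x :> D)"

lemma gradient_eq: "GDERIV f x :> D \<Longrightarrow> gradient f x = D"
  unfolding gradient_def
proof (rule the_equality)
  fix E assume D: "GDERIV f x :> D" and E: "GDERIV f x :> E"
  have "(\<lambda>h. h \<bullet> E) = (\<lambda>h. h \<bullet> D)"
    by (rule has_derivative_unique[OF E[unfolded gderiv_def] D[unfolded gderiv_def]])
  then have "h \<bullet> E = h \<bullet> D" for h
    by meson
  then show "E = D"
    by (metis inner_commute vector_eq_ldot)
qed

lemma gradient_works:
  assumes "f differentiable (at x)"
  shows "GDERIV f x :> gradient f x"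
proof -
  obtain f' where f': "(f has_derivative f') (at x)"
    using assms unfolding differentiable_def by blast
  have lin: "linear f'"
    using f' by (rule has_derivative_linear)
  have "f' = (\<lambda>h. h \<bullet> adjoint f' 1)"
    using adjoint_works[OF lin, of _ 1] by auto
  with f' have "GDERIV f x :> adjoint f' 1"
    unfolding gderiv_def by simp
  then show ?thesis
    using gradient_eq by metis
qed

text \<open>
  The feasible directions at \<open>x\<close>. On \<open>real ^ 'n\<close>, \<^const>\<open>infnorm\<close> is the maximum norm
  (see \<open>infnorm_cart\<close>).
\<close>

definition feasible_directions :: "(real ^ 'n) set \<Rightarrow> real ^ 'n \<Rightarrow> (real ^ 'n) set"
  where "feasible_directions X x = {d \<in> (\<lambda>y. y - x) ` X. infnorm d \<le> 1}"

text \<open>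
  On a linear order \<^const>\<open>Least\<close> picks the minimum of a predicate, provided it is attained;
  \<open>omega_min_attained\<close> shows that it is.
\<close>

definition omega :: "nat \<Rightarrow> (nat \<Rightarrow> real ^ 'n \<Rightarrow> real) \<Rightarrow> (real ^ 'n) set \<Rightarrow> real ^ 'n \<Rightarrow> real"
  where "omega k f X x =
    - (LEAST v. v \<in> (\<lambda>d. Max ((\<lambda>l. gradient (f l) x \<bullet> d) ` {1..k})) ` feasible_directions X x)"

lemma compact_feasible_directions:
  assumes "closed X"
  shows "compact (feasible_directions X x)"
proof -
  have "feasible_directions X x = (\<lambda>y. y - x) ` X \<inter> {d. infnorm d \<le> 1}"
    by (auto simp: feasible_directions_def)
  moreover have "closed ((\<lambda>y. y - x) ` X)"
    using closed_translation_subtract[OF assms, of x] .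
  moreover have "closed {d :: real ^ 'n. infnorm d \<le> 1}"
    by (intro closed_Collect_le continuous_intros)
  moreover have "bounded {d :: real ^ 'n. infnorm d \<le> 1}"
  proof (rule boundedI)
    fix d :: "real ^ 'n" assume "d \<in> {d. infnorm d \<le> 1}"
    then have "infnorm d \<le> 1"
      by simp
    then have "sqrt DIM(real ^ 'n) * infnorm d \<le> sqrt DIM(real ^ 'n) * 1"
      by (intro mult_left_mono) auto
    with norm_le_infnorm[of d] show "norm d \<le> sqrt DIM(real ^ 'n)"
      by linarith
  qed
  ultimately show ?thesis
    unfolding compact_eq_bounded_closed by (auto intro: closed_Int bounded_subset)
qed

lemma continuous_on_Max_image:
  fixes g :: "'i \<Rightarrow> 'a::topological_space \<Rightarrow> real"
  assumes "finite I" "I \<noteq> {}" "\<And>i. i \<in> I \<Longrightarrow> continuous_on S (g i)"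
  shows "continuous_on S (\<lambda>d. Max ((\<lambda>i. g i d) ` I))"
  using assms
proof (induction I rule: finite_ne_induct)
  case (insert i I)
  then have "(\<lambda>d. Max ((\<lambda>i. g i d) ` insert i I)) = (\<lambda>d. max (g i d) (Max ((\<lambda>i. g i d) ` I)))"
    by auto
  with insert show ?case
    by (auto intro!: continuous_on_max)
qed auto

lemma omega_min_attained:
  assumes "closed X" "x \<in> X" "k \<ge> 1"
  obtains d where "d \<in> feasible_directions X x"
    and "omega k f X x = - Max ((\<lambda>l. gradient (f l) x \<bullet> d) ` {1..k})"
    and "\<And>e. e \<in> feasible_directions X x \<Longrightarrow>
      Max ((\<lambda>l. gradient (f l) x \<bullet> d) ` {1..k}) \<le> Max ((\<lambda>l. gradient (f l) x \<bullet> e) ` {1..k})"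
proof -
  let ?m = "\<lambda>d. Max ((\<lambda>l. gradient (f l) x \<bullet> d) ` {1..k})"
  have "0 \<in> feasible_directions X x"
    using assms by (force simp: feasible_directions_def infnorm_0)
  then have "feasible_directions X x \<noteq> {}"
    by blast
  moreover have "continuous_on (feasible_directions X x) ?m"
    using assms by (intro continuous_on_Max_image continuous_intros) auto
  ultimately obtain d where d: "d \<in> feasible_directions X x"
    and le: "\<And>e. e \<in> feasible_directions X x \<Longrightarrow> ?m d \<le> ?m e"
    using continuous_attains_inf[OF compact_feasible_directions[OF assms(1)]] by meson
  have "omega k f X x = - ?m d"
    unfolding omega_def using d le
    by (subst Least_equality[where x = "?m d"]) auto
  with d le that show ?thesis
    by blast
qed

end

(*
  omega is in fact Lipschitz continuous. Given a direction d feasible at x, some direction e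
  feasible at y is within a constant times dist x y of d: for X = UNIV take e = d; for convex X
  take e = (x + d - y) / (1 + r) with r the maximum norm of x - y, since the maximum norm of
  x + d - y is at most 1 + r. Bounded X makes the gradients bounded, so swapping d for e costs a
  constant times dist x y; for X = UNIV, where they may be unbounded, nothing is swapped.
*)
theory Submission
  imports Defs
begin

text \<open>Feasibility is stated in the maximum norm, while Cauchy-Schwarz needs the Euclidean one;
  the square root of the dimension is the price of the conversion.\<close>

lemma norm_le_sqrt_DIM_of_feasible:
  fixes X :: "(real ^ 'n) set"
  assumes "d \<in> feasible_directions X x"
  shows "norm d \<le> sqrt DIM(real ^ 'n)"
proof -
  have "infnorm d \<le> 1"
    using assms by (simp add: feasible_directions_def)
  then have "sqrt DIM(real ^ 'n) * infnorm d \<le> sqrt DIM(real ^ 'n) * 1"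
    by (intro mult_left_mono) auto
  with norm_le_infnorm[of d] show ?thesis
    by linarith
qed

lemma feasible_direction_nearby:
  fixes X :: "(real ^ 'n) set"
  assumes "convex X" "y \<in> X" and d: "d \<in> feasible_directions X x"
  obtains e where "e \<in> feasible_directions X y"
    and "norm (e - d) \<le> 2 * sqrt DIM(real ^ 'n) * norm (x - y)"
proof -
  obtain z where z: "z \<in> X" "d = z - x" and d1: "infnorm d \<le> 1"
    using d by (auto simp: feasible_directions_def)
  define r where "r = infnorm (x - y)"
  define t where "t = 1 / (1 + r)"
  have r0: "r \<ge> 0"
    by (simp add: r_def infnorm_pos_le)
  then have t: "0 \<le> t" "t \<le> 1" "t * (1 + r) = 1"
    by (auto simp: t_def)
  define e where "e = t *\<^sub>R (z - y)"
  \<comment> \<open>This point of the segment from \<open>y\<close> to \<open>z\<close> is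
    \<open>y + e\<close>, so shrinking \<open>z - y\<close> by \<open>t\<close> does not leave
    \<open>X\<close>.\<close>
  have "(1 - t) *\<^sub>R y + t *\<^sub>R z \<in> X"
    using assms z t by (intro convexD) auto
  then have "y + e \<in> X"
    by (simp add: e_def algebra_simps)
  then have "e \<in> (\<lambda>w. w - y) ` X"
    by (rule rev_image_eqI) simp
  moreover have "infnorm e \<le> 1"
  proof -
    have "infnorm (z - y) \<le> infnorm d + r"
      using infnorm_triangle[of d "x - y"] by (simp add: z r_def)
    then have "t * infnorm (z - y) \<le> t * (1 + r)"
      using d1 t by (intro mult_left_mono) auto
    then show ?thesis
      using t by (simp add: e_def infnorm_mul)
  qed
  ultimately have "e \<in> feasible_directions X y"
    by (simp add: feasible_directions_def)
  moreover have "norm (e - d) \<le> 2 * sqrt DIM(real ^ 'n) * norm (x - y)"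
  proof -
    \<comment> \<open>As \<open>z - y = d + (x - y)\<close>, the error consists of the shrinking of
      \<open>d\<close> and the scaled shift of the base point.\<close>
    have "e - d = (t - 1) *\<^sub>R d + t *\<^sub>R (x - y)"
      by (simp add: e_def z algebra_simps)
    then have "infnorm (e - d) \<le> (1 - t) * infnorm d + t * r"
      using infnorm_triangle[of "(t - 1) *\<^sub>R d" "t *\<^sub>R (x - y)"] t
      by (simp add: infnorm_mul r_def)
    also have "\<dots> \<le> (1 - t) * 1 + t * r"
      using d1 t by (intro add_right_mono mult_left_mono) auto
    \<comment> \<open>By the choice of \<open>t\<close>, \<open>1 - t = t * r\<close>: both errors
      have the same bound, whence the factor 2.\<close>
    also have "\<dots> = 2 * (t * r)"
      using t by (simp add: algebra_simps)
    also have "\<dots> \<le> 2 * r"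
      using mult_right_mono[of t 1 r] r0 t by simp
    also have "\<dots> \<le> 2 * norm (x - y)"
      by (simp add: r_def infnorm_le_norm)
    finally have "sqrt DIM(real ^ 'n) * infnorm (e - d) \<le> sqrt DIM(real ^ 'n) * (2 * norm (x - y))"
      by (intro mult_left_mono) auto
    from order_trans[OF norm_le_infnorm this] show ?thesis
      by (simp add: mult_ac)
  qed
  ultimately show thesis
    by (rule that)
qed

text \<open>The part common to both kinds of \<open>X\<close>. A minimizer at \<open>x\<close> is
  traded for a competitor at \<open>y\<close>; since the loss is the same for all \<open>l\<close>,
  it passes through the maximum and bounds the minimum at \<open>y\<close>. Exchanging
  \<open>x\<close> and \<open>y\<close> gives the other inequality.\<close>

lemma lipschitz_on_omega:
  assumes "closed X" "k \<ge> 1" "C \<ge> 0"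
    and swap: "\<And>x y d. \<lbrakk>x \<in> X; y \<in> X; d \<in> feasible_directions X x\<rbrakk> \<Longrightarrow>
      \<exists>e \<in> feasible_directions X y. \<forall>l \<in> {1..k}.
        gradient (f l) y \<bullet> e \<le> gradient (f l) x \<bullet> d + C * dist x y"
  shows "C-lipschitz_on X (omega k f X)"
proof -
  have le: "omega k f X x - omega k f X y \<le> C * dist x y" if xy: "x \<in> X" "y \<in> X" for x y
  proof -
    let ?m = "\<lambda>x d. Max ((\<lambda>l. gradient (f l) x \<bullet> d) ` {1..k})"
    obtain d where d: "d \<in> feasible_directions X x" "omega k f X x = - ?m x d"
      using omega_min_attained[OF assms(1) xy(1) assms(2)] by metis
    obtain e where e: "e \<in> feasible_directions X y"
      "\<And>l. l \<in> {1..k} \<Longrightarrow> gradient (f l) y \<bullet> e \<le> gradient (f l) x \<bullet> d + C * dist x y"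
      using swap[OF xy d(1)] by blast
    have "- omega k f X y \<le> ?m y e"
      using omega_min_attained[OF assms(1) xy(2) assms(2)] e(1) by (metis minus_minus)
    also have "?m y e \<le> ?m x d + C * dist x y"
    proof (rule Max.boundedI)
      fix v assume "v \<in> (\<lambda>l. gradient (f l) y \<bullet> e) ` {1..k}"
      then obtain l where l: "l \<in> {1..k}" "v = gradient (f l) y \<bullet> e"
        by blast
      then have "gradient (f l) x \<bullet> d \<le> ?m x d"
        by (intro Max_ge) auto
      with e(2)[OF l(1)] l(2) show "v \<le> ?m x d + C * dist x y"
        by linarith
    qed (use assms(2) in auto)
    finally show ?thesis
      using d(2) by linarith
  qed
  show ?thesis
  proof (rule lipschitz_onI)
    fix x y assume "x \<in> X" "y \<in> X"
    then show "dist (omega k f X x) (omega k f X y) \<le> C * dist x y"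
      using le[of x y] le[of y x] by (auto simp: dist_real_def dist_commute abs_le_iff)
  qed fact
qed

text \<open>Lipschitz constants are nonnegative, so their sum dominates each of them; unlike a
  maximum, it also makes sense for empty \<open>I\<close>.\<close>

lemma lipschitz_on_finite_family:
  assumes "finite I" "\<And>i. i \<in> I \<Longrightarrow> \<exists>L. L-lipschitz_on X (g i)"
  obtains L where "L \<ge> 0" "\<And>i. i \<in> I \<Longrightarrow> L-lipschitz_on X (g i)"
proof -
  obtain M where M: "\<And>i. i \<in> I \<Longrightarrow> (M i)-lipschitz_on X (g i)"
    using assms(2) by metis
  then have "M i \<ge> 0" if "i \<in> I" for i
    using that lipschitz_on_nonneg by blast
  then have "sum M I \<ge> 0" "\<And>i. i \<in> I \<Longrightarrow> M i \<le> sum M I"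
    using assms(1) by (auto intro: sum_nonneg member_le_sum)
  with M that show thesis
    by (meson lipschitz_on_le)
qed

text \<open>Here \<open>a\<close>, \<open>b\<close> stand for gradients at two points and
  \<open>d\<close>, \<open>e\<close> for directions there. The change of gradient is paired with the
  new direction, the change of direction with the old gradient, so the size \<open>r\<close> of the
  gradient enters only through \<open>r * s\<close>.\<close>

lemma inner_swap_le:
  fixes a b d e :: "'a::real_inner"
  assumes "norm (b - a) \<le> p" "norm e \<le> q" "norm a \<le> r" "norm (e - d) \<le> s"
  shows "b \<bullet> e \<le> a \<bullet> d + (p * q + r * s)"
proof -
  have "b \<bullet> e = a \<bullet> d + (b - a) \<bullet> e + a \<bullet> (e - d)"
    by (simp add: inner_diff)
  moreover have "(b - a) \<bullet> e \<le> p * q"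
    using norm_cauchy_schwarz mult_mono[OF assms(1,2)]
    by (meson assms(1) norm_ge_zero order_trans)
  moreover have "a \<bullet> (e - d) \<le> r * s"
    using norm_cauchy_schwarz mult_mono[OF assms(3,4)]
    by (meson assms(3) norm_ge_zero order_trans)
  ultimately show ?thesis
    by linarith
qed

theorem theorem2:
  fixes X :: "(real ^ 'n) set"
    and f :: "nat \<Rightarrow> real ^ 'n \<Rightarrow> real"
    and k :: nat
  assumes "X \<noteq> {}"
    and "X = UNIV \<or> (closed X \<and> bounded X \<and> convex X)"
    and "k \<ge> 1"
    and "\<And>l x. l \<in> {1..k} \<Longrightarrow> x \<in> X \<Longrightarrow> f l differentiable (at x)"
    and "\<And>l. l \<in> {1..k} \<Longrightarrow> continuous_on X (gradient (f l))"
    and "\<And>l. l \<in> {1..k} \<Longrightarrow> \<exists>L. L-lipschitz_on X (gradient (f l))"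
  shows "uniformly_continuous_on X (omega k f X)"
proof -
  let ?c = "sqrt DIM(real ^ 'n)"
  obtain L where L: "L \<ge> 0" "\<And>l. l \<in> {1..k} \<Longrightarrow> L-lipschitz_on X (gradient (f l))"
    using lipschitz_on_finite_family[of "{1..k}" X "\<lambda>l. gradient (f l)"] assms(6) by blast
  have grad: "norm (gradient (f l) y - gradient (f l) x) \<le> L * dist x y"
    if "l \<in> {1..k}" "x \<in> X" "y \<in> X" for l x y
    using lipschitz_onD[OF L(2)[OF that(1)] that(3,2)] by (simp add: dist_norm norm_minus_commute)
  have "\<exists>C. C-lipschitz_on X (omega k f X)"
    using assms(2)
  proof (elim disjE conjE)
    assume X: "X = UNIV"
    have "(L * ?c)-lipschitz_on X (omega k f X)"
    proof (rule lipschitz_on_omega)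
      fix x y d assume xy: "x \<in> X" "y \<in> X" and d: "d \<in> feasible_directions X x"
      have "d \<in> feasible_directions X y"
        using d by (auto simp: feasible_directions_def X intro!: image_eqI[of _ _ "d + y"])
      moreover have "gradient (f l) y \<bullet> d \<le> gradient (f l) x \<bullet> d + L * ?c * dist x y"
        if "l \<in> {1..k}" for l
        \<comment> \<open>The direction is kept, so \<open>s = 0\<close> and the gradient's own norm
          can serve as \<open>r\<close>.\<close>
        using inner_swap_le[OF grad[OF that xy] norm_le_sqrt_DIM_of_feasible[OF d] order_refl, of d 0]
        by (simp add: mult_ac)
      ultimately show "\<exists>e \<in> feasible_directions X y. \<forall>l \<in> {1..k}.
          gradient (f l) y \<bullet> e \<le> gradient (f l) x \<bullet> d + L * ?c * dist x y"
        by blast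
    qed (use X assms(3) L(1) in auto)
    then show ?thesis ..
  next
    assume X: "closed X" "bounded X" "convex X"
    then have "compact (gradient (f l) ` X)" if "l \<in> {1..k}" for l
      using assms(5)[OF that] by (intro compact_continuous_image) (auto simp: compact_eq_bounded_closed)
    then have "bounded (\<Union>l \<in> {1..k}. gradient (f l) ` X)"
      by (intro bounded_UN) (auto intro: compact_imp_bounded)
    then obtain G where G: "G > 0" "\<And>l x. l \<in> {1..k} \<Longrightarrow> x \<in> X \<Longrightarrow> norm (gradient (f l) x) \<le> G"
      unfolding bounded_pos by blast
    \<comment> \<open>The first summand pays for the change of gradient along \<open>e\<close>, the
      second for replacing \<open>d\<close> by \<open>e\<close> against a gradient of norm at most
      \<open>G\<close>.\<close>
    let ?C = "L * ?c + G * (2 * ?c)"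
    have "?C-lipschitz_on X (omega k f X)"
    proof (rule lipschitz_on_omega)
      fix x y d assume xy: "x \<in> X" "y \<in> X" and d: "d \<in> feasible_directions X x"
      obtain e where e: "e \<in> feasible_directions X y" "norm (e - d) \<le> 2 * ?c * norm (x - y)"
        using feasible_direction_nearby[OF X(3) xy(2) d] .
      have "gradient (f l) y \<bullet> e \<le> gradient (f l) x \<bullet> d + ?C * dist x y" if "l \<in> {1..k}" for l
        using inner_swap_le[OF grad[OF that xy] norm_le_sqrt_DIM_of_feasible[OF e(1)]
            G(2)[OF that xy(1)] e(2)]
        by (simp add: dist_norm algebra_simps)
      with e(1) show "\<exists>e \<in> feasible_directions X y. \<forall>l \<in> {1..k}.
          gradient (f l) y \<bullet> e \<le> gradient (f l) x \<bullet> d + ?C * dist x y"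
        by blast
    qed (use X assms(3) L(1) G(1) in auto)
    then show ?thesis ..
  qed
  then show ?thesis
    using lipschitz_on_uniformly_continuous by blast
qed

end
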